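(* Let $G$ be a circuit with leaves labeled by literals over $\mathbf{I}$ and $\mathbf{X}$, let $\ell$ be a literal over $\mathbf{X}$ with underlying variable $v_\ell$, let $S_\ell$ (resp. $S_{\neg\ell}$) be the set of all $\ell$-leaves (resp. $\neg\ell$-leaves) of $G$, and suppose $S\subseteq S_\ell$ is $\wedge$-unrealizable in $G$. Let $p\notin\mathrm{set}(\mathbf{X})\cup\mathrm{set}(\mathbf{I})$ be fresh. Let $E=G|_{S_\ell\setminus S:(p\wedge\ell),\,S_{\neg\ell}:(\neg p\wedge\neg\ell)}$ and $H=E|_{\ell=\top,\neg\ell=\top}$ (so the leaves of $H$ are labeled by literals over $\mathbf{X}\setminus(v_\ell)$, $\mathbf{I}$ and $p$). Then: (1) $\exists v_\ell\,\varphi_G\iff\exists p\,\varphi_H\iff\exists v_\ell\,\varphi_{G|_{S:\top}}$. (2) If $\Psi_H(\mathbf{I})$ is a Skolem function vector for $(\mathbf{X}\setminus(v_\ell),p)$ in $\varphi_H$, then the projection of $\Psi_H$ onto the components for $\mathbf{X}\setminus(v_\ell)$, augmented with the function $\varphi_{E|_{\ell=\top,\neg\ell=\bot}}(\Psi_H(\mathbf{I}),\mathbf{I})$ as the Skolem function for the literal $\ell$, gives a Skolem function vector $\Psi_G(\mathbf{I})$ for $\mathbf{X}$ in $\varphi_G$.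
   Context: Boolean values are $\bot,\top$. $\mathbf{I}$ (system inputs) and $\mathbf{X}$ (system outputs) are disjoint sequences of Boolean variables; $\mathrm{set}(\mathbf{V})$ is the set of variables of $\mathbf{V}$; $\mathbf{X}\setminus(v)$ is $\mathbf{X}$ with $v$ removed. A circuit is an NNF circuit: a rooted DAG whose nodes are all descendants of the root, internal nodes labeled $\wedge$ or $\vee$ with two children, leaves labeled by literals or constants $\top,\bot$ (labels may repeat). $\varphi_G$ is the represented formula, $[\![\varphi_G]\!]$ its Boolean function. An $\ell$-leaf is a leaf labeled $\ell$. $G|_{L:b}$ relabels each leaf in a set $L$ by $b$, where relabeling by a formula such as $p\wedge\ell$ means replacing the leaf by a circuit for that formula; $G|_{\ell_1=b_1,\dots}$ relabels all $\ell_j$-leaves by $b_j$ ($\ell$ and $\neg\ell$ are distinct literals). $[\![\varphi]\!]_\sigma$ denotes substitution of an assignment $\sigma$. For a literal $\ell$ labeling a leaf of $G$ with variable $v_\ell$ and fresh $w,w'$: $\ell$ is $\wedge$-realizable in $G$ iff some assignment $\sigma$ to all variables of $G$ other than $v_\ell$ gives $[\![G|_{\ell=w,\neg\ell=w'}]\!]_\sigma=[\![w\wedge w']\!]$, else $\wedge$-unrealizable. A set $S$ of $\ell$-leaves, with $S'$ the set of all $\ell$-leaves, is $\wedge$-(un)realizable in $G$ iff $\ell$ is $\wedge$-(un)realizable in $G|_{S'\setminus S:\bot}$. A Skolem function vector for outputs $\mathbf{Y}$ in $\varphi(\mathbf{Y},\mathbf{I})$ is a sequence $\Psi(\mathbf{I})$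 of formulas over $\mathbf{I}$, one per variable of $\mathbf{Y}$, with $\forall\mathbf{I}\,(\varphi(\Psi(\mathbf{I}),\mathbf{I})\Leftrightarrow\exists\mathbf{Y}\varphi(\mathbf{Y},\mathbf{I}))$. A Skolem function for a literal $\ell$ gives the value of $\ell$ (so $v_\ell$ receives it if $\ell=v_\ell$ and its negation if $\ell=\neg v_\ell$). *)

theory Defs
  imports Main "HOL-Library.Infinite_Typeclass"
begin

datatype 'v literal = Pos 'v | Neg 'v

fun lit_var :: "'v literal \<Rightarrow> 'v" where
  "lit_var (Pos v) = v"
| "lit_var (Neg v) = v"

fun lit_neg :: "'v literal \<Rightarrow> 'v literal" where
  "lit_neg (Pos v) = Neg v"
| "lit_neg (Neg v) = Pos v"

datatype (form_vars: 'v) form =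
  FConst bool
| FVar 'v
| FNot "'v form"
| FAnd "'v form" "'v form"
| FOr "'v form" "'v form"

primrec eval :: "'v form \<Rightarrow> ('v \<Rightarrow> bool) \<Rightarrow> bool" where
  "eval (FConst b) s = b"
| "eval (FVar v) s = s v"
| "eval (FNot f) s = (\<not> eval f s)"
| "eval (FAnd f g) s = (eval f s \<and> eval g s)"
| "eval (FOr f g) s = (eval f s \<or> eval g s)"

primrec subst :: "('v \<Rightarrow> 'v form) \<Rightarrow> 'v form \<Rightarrow> 'v form" where
  "subst r (FConst b) = FConst b"
| "subst r (FVar v) = r v"
| "subst r (FNot f) = FNot (subst r f)"
| "subst r (FAnd f g) = FAnd (subst r f) (subst r g)"
| "subst r (FOr f g) = FOr (subst r f) (subst r g)"

definition subst_assignment :: "('v \<rightharpoonup> bool) \<Rightarrow> 'v form \<Rightarrow> 'v form" where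
  "subst_assignment s = subst (\<lambda>v. case s v of None \<Rightarrow> FVar v | Some b \<Rightarrow> FConst b)"

text \<open>Existential quantification acts on Boolean functions, since the formulas above are
  quantifier-free.\<close>

definition ex_var :: "'v \<Rightarrow> (('v \<Rightarrow> bool) \<Rightarrow> bool) \<Rightarrow> (('v \<Rightarrow> bool) \<Rightarrow> bool)" where
  "ex_var v F = (\<lambda>s. \<exists>b. F (s(v := b)))"

definition ex_vars :: "'v list \<Rightarrow> (('v \<Rightarrow> bool) \<Rightarrow> bool) \<Rightarrow> (('v \<Rightarrow> bool) \<Rightarrow> bool)" where
  "ex_vars = foldr ex_var"

datatype 'v leaf_label = Lit "'v literal" | Const bool

datatype (children: 'n, dead 'v) gate =
  Leaf "'v leaf_label"
| AndGate 'n 'n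
| OrGate 'n 'n
  for map: map_gate

record ('n, 'v) circuit =
  nodes :: "'n set"
  root :: 'n
  gate :: "'n \<Rightarrow> ('n, 'v) gate"

definition edges :: "('n, 'v) circuit \<Rightarrow> ('n \<times> 'n) set" where
  "edges G = {(n, c). n \<in> nodes G \<and> c \<in> children (gate G n)}"

definition nnf_circuit :: "('n, 'v) circuit \<Rightarrow> bool" where
  "nnf_circuit G \<longleftrightarrow>
     finite (nodes G) \<and> root G \<in> nodes G \<and> edges G \<subseteq> nodes G \<times> nodes G \<and>
     acyclic (edges G) \<and> (\<forall>n \<in> nodes G. (root G, n) \<in> (edges G)\<^sup>*)"

fun lit_form :: "'v literal \<Rightarrow> 'v form" where
  "lit_form (Pos v) = FVar v"
| "lit_form (Neg v) = FNot (FVar v)"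

fun label_form :: "'v leaf_label \<Rightarrow> 'v form" where
  "label_form (Lit l) = lit_form l"
| "label_form (Const b) = FConst b"

text \<open>The guard only serves termination: outside well-formed circuits the value is a dummy.\<close>

function node_form :: "('n, 'v) circuit \<Rightarrow> 'n \<Rightarrow> 'v form" where
  "node_form G n =
     (if nnf_circuit G \<and> n \<in> nodes G then
        (case gate G n of
           Leaf a \<Rightarrow> label_form a
         | AndGate c d \<Rightarrow> FAnd (node_form G c) (node_form G d)
         | OrGate c d \<Rightarrow> FOr (node_form G c) (node_form G d))
      else FConst False)"
  by pat_completeness auto

lemma card_descendants_less:
  assumes "nnf_circuit G" "n \<in> nodes G" "c \<in> children (gate G n)"
  shows "card ((edges G)\<^sup>+ `` {c}) < card ((edges G)\<^sup>+ `` {n})"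
proof (rule psubset_card_mono)
  have e: "(n, c) \<in> edges G" using assms by (auto simp: edges_def)
  have "(edges G)\<^sup>+ \<subseteq> nodes G \<times> nodes G"
    using assms(1) trancl_subset_Sigma unfolding nnf_circuit_def by blast
  then show "finite ((edges G)\<^sup>+ `` {n})"
    using assms(1) unfolding nnf_circuit_def by (auto intro: finite_subset)
  have "(edges G)\<^sup>+ `` {c} \<subseteq> (edges G)\<^sup>+ `` {n}"
    using e by (auto intro: trancl_into_trancl2)
  moreover have "c \<in> (edges G)\<^sup>+ `` {n}" using e by auto
  moreover have "c \<notin> (edges G)\<^sup>+ `` {c}"
    using assms(1) by (auto simp: nnf_circuit_def acyclic_def)
  ultimately show "(edges G)\<^sup>+ `` {c} \<subset> (edges G)\<^sup>+ `` {n}" by blast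
qed

termination node_form
  by (relation "measure (\<lambda>(G, n). card ((edges G)\<^sup>+ `` {n}))") (auto intro!: card_descendants_less)

declare node_form.simps [simp del]

definition circuit_form :: "('n, 'v) circuit \<Rightarrow> 'v form" where
  "circuit_form G = node_form G (root G)"

definition lit_leaves :: "('n, 'v) circuit \<Rightarrow> 'v literal \<Rightarrow> 'n set" where
  "lit_leaves G l = {n \<in> nodes G. gate G n = Leaf (Lit l)}"

definition circuit_vars :: "('n, 'v) circuit \<Rightarrow> 'v set" where
  "circuit_vars G = {lit_var l | l. lit_leaves G l \<noteq> {}}"

definition relabel_leaves :: "('n, 'v) circuit \<Rightarrow> 'n set \<Rightarrow> 'v leaf_label \<Rightarrow> ('n, 'v) circuit" where
  "relabel_leaves G L b = G\<lparr>gate := (\<lambda>n. if n \<in> L then Leaf b else gate G n)\<rparr>"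

text \<open>Simultaneous relabeling: every leaf labeled by a literal \<open>l\<close> receives the label \<open>f l\<close>. As
  \<^const>\<open>Lit\<close> itself leaves the circuit unchanged, \<open>Lit(l := b, l' := b')\<close> describes the
  relabeling of the \<open>l\<close>-leaves by \<open>b\<close> and of the \<open>l'\<close>-leaves by \<open>b'\<close>.\<close>

definition relabel_lits ::
  "('n, 'v) circuit \<Rightarrow> ('v literal \<Rightarrow> 'v leaf_label) \<Rightarrow> ('n, 'v) circuit" where
  "relabel_lits G f =
     G\<lparr>gate := (\<lambda>n. case gate G n of Leaf (Lit l) \<Rightarrow> Leaf (f l) | _ \<Rightarrow> gate G n)\<rparr>"

text \<open>Each leaf \<open>n\<close> with \<open>R n = Some C\<close> is replaced by its own copy of the circuit \<open>C\<close>, whose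
  nodes are the \<open>Inr (n, m)\<close>; the edges into \<open>n\<close> are redirected to the root of that copy.\<close>

definition replaced_node :: "('n \<Rightarrow> ('m, 'v) circuit option) \<Rightarrow> 'n \<Rightarrow> 'n + 'n \<times> 'm" where
  "replaced_node R n = (case R n of None \<Rightarrow> Inl n | Some C \<Rightarrow> Inr (n, root C))"

definition replace_leaves ::
  "('n, 'v) circuit \<Rightarrow> ('n \<Rightarrow> ('m, 'v) circuit option) \<Rightarrow> ('n + 'n \<times> 'm, 'v) circuit" where
  "replace_leaves G R =
     \<lparr>nodes = {Inl n | n. n \<in> nodes G \<and> R n = None}
              \<union> {Inr (n, m) | n m C. n \<in> nodes G \<and> R n = Some C \<and> m \<in> nodes C},
      root = replaced_node R (root G),
      gate = (\<lambda>x. case x of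
                Inl n \<Rightarrow> map_gate (replaced_node R) (gate G n)
              | Inr (n, m) \<Rightarrow> map_gate (\<lambda>m'. Inr (n, m')) (gate (the (R n)) m))\<rparr>"

definition lit_conj_circuit :: "'v literal \<Rightarrow> 'v literal \<Rightarrow> (nat, 'v) circuit" where
  "lit_conj_circuit l l' =
     \<lparr>nodes = {0, 1, 2}, root = 0,
      gate = (\<lambda>n. if n = 0 then AndGate 1 2 else if n = 1 then Leaf (Lit l) else Leaf (Lit l'))\<rparr>"

text \<open>The variable type is infinite, so that fresh variables \<open>w\<close> and \<open>w'\<close> exist for every circuit.\<close>

definition and_realizable :: "('n, 'v::infinite) circuit \<Rightarrow> 'v literal \<Rightarrow> bool" where
  "and_realizable G l \<longleftrightarrow>
     (\<exists>w w' s.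
        w \<noteq> w' \<and> w \<notin> insert (lit_var l) (circuit_vars G) \<and>
        w' \<notin> insert (lit_var l) (circuit_vars G) \<and>
        dom s = circuit_vars G - {lit_var l} \<and>
        eval (subst_assignment s (circuit_form
          (relabel_lits G (Lit(l := Lit (Pos w), lit_neg l := Lit (Pos w'))))))
        = eval (FAnd (FVar w) (FVar w')))"

definition and_realizable_set :: "('n, 'v::infinite) circuit \<Rightarrow> 'v literal \<Rightarrow> 'n set \<Rightarrow> bool" where
  "and_realizable_set G l S \<longleftrightarrow>
     and_realizable (relabel_leaves G (lit_leaves G l - S) (Const False)) l"

text \<open>The substitution that puts the \<open>i\<close>-th formula of \<open>\<Psi>\<close> for the \<open>i\<close>-th variable of \<open>Y\<close>.\<close>

definition vector_subst :: "'v list \<Rightarrow> 'v form list \<Rightarrow> 'v \<Rightarrow> 'v form" where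
  "vector_subst Y \<Psi> v = (case map_of (zip Y \<Psi>) v of None \<Rightarrow> FVar v | Some f \<Rightarrow> f)"

definition skolem_vector :: "'v list \<Rightarrow> 'v list \<Rightarrow> 'v form \<Rightarrow> 'v form list \<Rightarrow> bool" where
  "skolem_vector Y I f \<Psi> \<longleftrightarrow>
     length \<Psi> = length Y \<and> (\<forall>g \<in> set \<Psi>. form_vars g \<subseteq> set I) \<and>
     (\<forall>s. eval (subst (vector_subst Y \<Psi>) f) s \<longleftrightarrow> ex_vars Y (eval f) s)"

text \<open>The function received by the variable of a literal whose Skolem function is \<open>g\<close>.\<close>

fun var_skolem :: "'v literal \<Rightarrow> 'v form \<Rightarrow> 'v form" where
  "var_skolem (Pos v) g = g"
| "var_skolem (Neg v) g = FNot g"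

end

(* Let K a b c be the value of G when the leaves in S, the other l-leaves and the (lit_neg l)-leaves
   carry a, b and c.  K is monotone, and G, G|S:True, H and E|l=True,lit_neg l=False are
   K x x (\<not> x), K True x (\<not> x), K True p (\<not> p) and K True p False.  Unrealizability of S says that
   K True False True implies K True False False or K False False True, so any solution of H with
   p false that does not already solve G with l false yields one of G with l true.  The value
   K True p False tells these cases apart, hence serves as the Skolem function for l. *)

theory Submission
  imports Defs
begin

section \<open>Literals, and node values computed from prescribed leaf values\<close>

section \<open>Values of nodes\<close>

lemma lit_neg_neq [simp]: "lit_neg l \<noteq> l" "l \<noteq> lit_neg l"
  by (cases l; simp)+

lemma lit_var_eqD: "lit_var l' = lit_var l \<Longrightarrow> l' = l \<or> l' = lit_neg l"
  by (cases l; cases l') auto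

lemma eval_lit_neg [simp]: "eval (lit_form (lit_neg l)) s \<longleftrightarrow> \<not> eval (lit_form l) s"
  by (cases l) auto

lemma eval_lit_form_cong: "s (lit_var l) = t (lit_var l) \<Longrightarrow> eval (lit_form l) s = eval (lit_form l) t"
  by (cases l) auto

lemma form_vars_lit_form [simp]: "form_vars (lit_form l) = {lit_var l}"
  by (cases l) auto

text \<open>Leaf values come node by node from \<open>V\<close> and not from the labels, so that
  equally labeled leaves can be set differently.\<close>

inductive holds_at :: "('n, 'v) circuit \<Rightarrow> ('n \<Rightarrow> bool) \<Rightarrow> 'n \<Rightarrow> bool" for G V where
  leaf: "gate G n = Leaf a \<Longrightarrow> V n \<Longrightarrow> holds_at G V n"
| conj: "gate G n = AndGate c d \<Longrightarrow> holds_at G V c \<Longrightarrow> holds_at G V d \<Longrightarrow> holds_at G V n"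
| disj1: "gate G n = OrGate c d \<Longrightarrow> holds_at G V c \<Longrightarrow> holds_at G V n"
| disj2: "gate G n = OrGate c d \<Longrightarrow> holds_at G V d \<Longrightarrow> holds_at G V n"

lemma holds_at_gate:
  "gate G n = Leaf a \<Longrightarrow> holds_at G V n \<longleftrightarrow> V n"
  "gate G n = AndGate c d \<Longrightarrow> holds_at G V n \<longleftrightarrow> holds_at G V c \<and> holds_at G V d"
  "gate G n = OrGate c d \<Longrightarrow> holds_at G V n \<longleftrightarrow> holds_at G V c \<or> holds_at G V d"
  by (subst holds_at.simps; auto)+

lemma nnf_children:
  "nnf_circuit G \<Longrightarrow> n \<in> nodes G \<Longrightarrow> c \<in> children (gate G n) \<Longrightarrow> c \<in> nodes G"
  by (auto simp: nnf_circuit_def edges_def)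

text \<open>Induction on the number of proper descendants, the measure behind the termination of
  \<open>node_form\<close>.\<close>

lemma nnf_induct [consumes 2, case_names Leaf And Or]:
  assumes nnf: "nnf_circuit G" and n: "n \<in> nodes G"
    and leaf: "\<And>n a. n \<in> nodes G \<Longrightarrow> gate G n = Leaf a \<Longrightarrow> P n"
    and conj: "\<And>n c d. n \<in> nodes G \<Longrightarrow> gate G n = AndGate c d \<Longrightarrow> c \<in> nodes G \<Longrightarrow> d \<in> nodes G \<Longrightarrow>
      P c \<Longrightarrow> P d \<Longrightarrow> P n"
    and disj: "\<And>n c d. n \<in> nodes G \<Longrightarrow> gate G n = OrGate c d \<Longrightarrow> c \<in> nodes G \<Longrightarrow> d \<in> nodes G \<Longrightarrow>
      P c \<Longrightarrow> P d \<Longrightarrow> P n"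
  shows "P n"
  using n
proof (induction "card ((edges G)\<^sup>+ `` {n})" arbitrary: n rule: less_induct)
  case less
  have ch: "P c \<and> c \<in> nodes G" if "c \<in> children (gate G n)" for c
    using less card_descendants_less[OF nnf less.prems that] nnf_children[OF nnf less.prems that]
    by blast
  show ?case
  proof (cases "gate G n")
    case (Leaf a)
    then show ?thesis using leaf less.prems by blast
  next
    case (AndGate c d)
    then show ?thesis using conj[OF less.prems AndGate] ch[of c] ch[of d] by simp
  next
    case (OrGate c d)
    then show ?thesis using disj[OF less.prems OrGate] ch[of c] ch[of d] by simp
  qed
qed

lemma node_form_gate:
  assumes "nnf_circuit G" "n \<in> nodes G"
  shows "gate G n = Leaf a \<Longrightarrow> node_form G n = label_form a"
    and "gate G n = AndGate c d \<Longrightarrow> node_form G n = FAnd (node_form G c) (node_form G d)"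
    and "gate G n = OrGate c d \<Longrightarrow> node_form G n = FOr (node_form G c) (node_form G d)"
  using assms by (simp_all add: node_form.simps[of G n])

text \<open>Inner gates are conjunctions and disjunctions only, so raising leaf values never lowers
  the value above them.\<close>

lemma holds_at_mono:
  assumes "nnf_circuit G" "n \<in> nodes G"
    and "\<And>n a. n \<in> nodes G \<Longrightarrow> gate G n = Leaf a \<Longrightarrow> V n \<Longrightarrow> W n"
  shows "holds_at G V n \<Longrightarrow> holds_at G W n"
  using assms(1,2)
  by (induction rule: nnf_induct) (use assms(3) in \<open>auto simp: holds_at_gate\<close>)

text \<open>The embedding \<open>h\<close> of \<open>G\<close> into \<open>G'\<close> need only respect the inner gates: a leaf of \<open>G\<close> may be
  sent to the root of a larger subcircuit, whose value \<open>V\<close> records.\<close>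

lemma eval_node_form_embed:
  assumes "nnf_circuit G" "n \<in> nodes G" and G': "nnf_circuit G'"
    and leaf: "\<And>n a. n \<in> nodes G \<Longrightarrow> gate G n = Leaf a \<Longrightarrow> eval (node_form G' (h n)) s = V n"
    and inner: "\<And>n. n \<in> nodes G \<Longrightarrow> \<nexists>a. gate G n = Leaf a \<Longrightarrow>
      h n \<in> nodes G' \<and> gate G' (h n) = map_gate h (gate G n)"
  shows "eval (node_form G' (h n)) s = holds_at G V n"
  using assms(1,2)
proof (induction rule: nnf_induct)
  case (Leaf n a)
  then show ?case using leaf by (simp add: holds_at_gate)
next
  case (And n c d)
  then show ?case using inner[of n] by (simp add: holds_at_gate node_form_gate[OF G'])
next
  case (Or n c d)
  then show ?case using inner[of n] by (simp add: holds_at_gate node_form_gate[OF G'])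
qed

lemma form_vars_node_form:
  assumes "nnf_circuit G" "n \<in> nodes G"
  shows "form_vars (node_form G n) \<subseteq> circuit_vars G"
  using assms
proof (induction rule: nnf_induct)
  case (Leaf n a)
  then show ?case
    using assms(1) by (cases a) (auto simp: node_form_gate circuit_vars_def lit_leaves_def)
next
  case (And n c d)
  then show ?case using assms(1) by (simp add: node_form_gate)
next
  case (Or n c d)
  then show ?case using assms(1) by (simp add: node_form_gate)
qed

lemma nnf_root: "nnf_circuit G \<Longrightarrow> root G \<in> nodes G"
  by (simp add: nnf_circuit_def)

text \<open>Leaves room for the fresh variables \<open>w\<close> and \<open>w'\<close> in an
  infinite type.\<close>

lemma finite_circuit_vars:
  assumes "nnf_circuit G"
  shows "finite (circuit_vars G)"
proof (rule finite_subset)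
  show "circuit_vars G \<subseteq> (\<lambda>n. case gate G n of Leaf (Lit l) \<Rightarrow> lit_var l) ` nodes G"
    by (force simp: circuit_vars_def lit_leaves_def)
  show "finite ((\<lambda>n. case gate G n of Leaf (Lit l) \<Rightarrow> lit_var l) ` nodes G)"
    using assms by (simp add: nnf_circuit_def)
qed

section \<open>Well-formedness under relabeling and under replacement of leaves by circuits\<close>

section \<open>Relabeling and replacing leaves\<close>

text \<open>Edges depend on a gate only through its children, and exchanging leaf labels changes no
  children.\<close>

lemma nnf_circuit_regate:
  assumes "nnf_circuit G" "\<And>n. n \<in> nodes G \<Longrightarrow> children (f n) = children (gate G n)"
  shows "nnf_circuit (G\<lparr>gate := f\<rparr>)"
proof -
  have "edges (G\<lparr>gate := f\<rparr>) = edges G"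
    using assms(2) by (auto simp: edges_def)
  then show ?thesis using assms(1) by (simp add: nnf_circuit_def)
qed

lemma gate_relabel_lits:
  "gate G n = Leaf (Lit l) \<Longrightarrow> gate (relabel_lits G f) n = Leaf (f l)"
  "\<nexists>l. gate G n = Leaf (Lit l) \<Longrightarrow> gate (relabel_lits G f) n = gate G n"
  by (auto simp: relabel_lits_def split: gate.split leaf_label.split)

lemma nnf_relabel_lits:
  assumes "nnf_circuit G"
  shows "nnf_circuit (relabel_lits G f)"
  unfolding relabel_lits_def using assms
  by (rule nnf_circuit_regate) (auto split: gate.splits leaf_label.splits)

lemma nnf_relabel_leaves:
  assumes "nnf_circuit G" "L \<subseteq> lit_leaves G l"
  shows "nnf_circuit (relabel_leaves G L b)"
  unfolding relabel_leaves_def using assms(1)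
  by (rule nnf_circuit_regate) (use assms(2) in \<open>auto simp: lit_leaves_def\<close>)

lemma nnf_lit_conj_circuit: "nnf_circuit (lit_conj_circuit l l')"
proof -
  let ?C = "lit_conj_circuit l l'"
  have e: "edges ?C = {(0, 1), (0, 2)}"
    by (auto simp: edges_def lit_conj_circuit_def split: if_splits)
  have "(edges ?C)\<^sup>+ \<subseteq> {(0, 1), (0, 2)}"
    unfolding e by (rule trancl_id[THEN equalityD1]) (auto simp: trans_def)
  then have "acyclic (edges ?C)" by (auto simp: acyclic_def)
  then show ?thesis
    by (auto simp: nnf_circuit_def e) (auto simp: lit_conj_circuit_def)
qed

text \<open>\<open>f\<close> places the three nodes of a \<open>lit_conj_circuit\<close> inside
  \<open>E\<close>; \<open>a\<close> and \<open>b\<close> are arbitrary because the copy may have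
  been relabeled afterwards.\<close>

lemma eval_lit_conj_copy:
  assumes "nnf_circuit E"
    and "\<And>m. m \<in> {0, 1, 2} \<Longrightarrow> f m \<in> nodes E"
    and "gate E (f 0) = AndGate (f 1) (f (2::nat))"
    and "gate E (f 1) = Leaf a" "gate E (f 2) = Leaf b"
  shows "eval (node_form E (f 0)) s \<longleftrightarrow> eval (label_form a) s \<and> eval (label_form b) s"
  using assms by (simp add: node_form_gate)

text \<open>Only leaves are replaced, so a path descends in \<open>G\<close> and then possibly
  inside a single copy, without a way back.\<close>

lemma nnf_replace_leaves:
  assumes G: "nnf_circuit G"
    and R: "\<And>n C. n \<in> nodes G \<Longrightarrow> R n = Some C \<Longrightarrow> nnf_circuit C \<and> (\<exists>a. gate G n = Leaf a)"
  shows "nnf_circuit (replace_leaves G R)"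
proof -
  let ?E = "replace_leaves G R"
  let ?h = "replaced_node R"
  \<comment> \<open>The node of \<open>G\<close> from which a node of \<open>?E\<close>
    stems.\<close>
  define base :: "'a + 'a \<times> 'c \<Rightarrow> 'a" where "base = case_sum id fst"
  have base_h [simp]: "base (?h n) = n" for n
    by (auto simp: base_def replaced_node_def split: option.split)
  have nodes_iff: "Inl n \<in> nodes ?E \<longleftrightarrow> n \<in> nodes G \<and> R n = None"
    "Inr (n, m) \<in> nodes ?E \<longleftrightarrow> n \<in> nodes G \<and> (\<exists>C. R n = Some C \<and> m \<in> nodes C)" for n m
    by (auto simp: replace_leaves_def)
  have h_nodes: "?h n \<in> nodes ?E" if "n \<in> nodes G" for n
    using that R[OF that]
    by (auto simp: replaced_node_def nodes_iff nnf_root split: option.split)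
  have edges_E: "edges ?E = {(Inl n, ?h c) |n c. R n = None \<and> (n, c) \<in> edges G}
      \<union> {(Inr (n, m), Inr (n, m')) |n m m' C. n \<in> nodes G \<and> R n = Some C \<and> (m, m') \<in> edges C}"
    (is "_ = ?A \<union> ?B")
  proof (rule set_eqI, clarify)
    fix x y
    show "(x, y) \<in> edges ?E \<longleftrightarrow> (x, y) \<in> ?A \<union> ?B"
    proof (cases x)
      case (Inl n)
      then show ?thesis
        by (auto simp: edges_def nodes_iff gate.set_map) (auto simp: replace_leaves_def gate.set_map)
    next
      case (Inr nm)
      then obtain n m where "x = Inr (n, m)" by (cases nm) auto
      then show ?thesis
        by (auto simp: edges_def nodes_iff) (auto simp: replace_leaves_def gate.set_map)
    qed
  qed
  have "finite (nodes ?E)"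
  proof -
    have "nodes ?E \<subseteq> Inl ` nodes G \<union> Inr ` (SIGMA n:nodes G. case R n of None \<Rightarrow> {} | Some C \<Rightarrow> nodes C)"
      by (auto simp: replace_leaves_def)
    moreover have "finite (case R n of None \<Rightarrow> {} | Some C \<Rightarrow> nodes C)" if "n \<in> nodes G" for n
      using R[OF that] by (auto simp: nnf_circuit_def split: option.split)
    ultimately show ?thesis
      using G by (auto simp: nnf_circuit_def intro: finite_subset)
  qed
  moreover have "root ?E = ?h (root G)" by (simp add: replace_leaves_def)
  then have "root ?E \<in> nodes ?E" using h_nodes nnf_root[OF G] by simp
  moreover have "edges ?E \<subseteq> nodes ?E \<times> nodes ?E"
  proof -
    have "edges G \<subseteq> nodes G \<times> nodes G" using G by (simp add: nnf_circuit_def)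
    moreover have "edges C \<subseteq> nodes C \<times> nodes C" if "n \<in> nodes G" "R n = Some C" for n C
      using R[OF that] by (simp add: nnf_circuit_def)
    ultimately show ?thesis
      unfolding edges_E using h_nodes by (fastforce simp: nodes_iff)
  qed
  moreover have "acyclic (edges ?E)"
  proof -
    \<comment> \<open>A transitive irreflexive relation containing all edges excludes cycles: either
      the origins descend strictly in \<open>G\<close>, or both nodes lie in one copy and descend
      strictly there.\<close>
    define Q where "Q = {(x, y). (base x, base y) \<in> (edges G)\<^sup>+ \<or>
      (\<exists>n m m' C. x = Inr (n, m) \<and> y = Inr (n, m') \<and> n \<in> nodes G \<and> R n = Some C \<and> (m, m') \<in> (edges C)\<^sup>+)}"
    have "edges ?E \<subseteq> Q"
      unfolding edges_E Q_def by (auto simp: base_def[THEN fun_cong, of "Inl _"])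
    moreover have "trans Q"
    proof (rule transI)
      fix x y z assume "(x, y) \<in> Q" "(y, z) \<in> Q"
      then show "(x, z) \<in> Q"
        unfolding Q_def by (auto simp: base_def intro: trancl_trans)
    qed
    ultimately have "(edges ?E)\<^sup>+ \<subseteq> Q"
      by (metis trancl_id trancl_mono_subset)
    moreover have "(x, x) \<notin> Q" for x
      using G R by (auto simp: Q_def nnf_circuit_def acyclic_def)
    ultimately show ?thesis by (auto simp: acyclic_def)
  qed
  moreover have "\<forall>x \<in> nodes ?E. (root ?E, x) \<in> (edges ?E)\<^sup>*"
  proof -
    have reach: "(root ?E, ?h n) \<in> (edges ?E)\<^sup>*" if "(root G, n) \<in> (edges G)\<^sup>*" for n
      using that
    proof (induction rule: rtrancl_induct)
      case base
      then show ?case by (simp add: replace_leaves_def)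
    next
      case (step n c)
      then have "n \<in> nodes G" "c \<in> children (gate G n)" by (auto simp: edges_def)
      \<comment> \<open>A node with a child is no leaf, hence not replaced, so paths of
        \<open>G\<close> lift edge by edge.\<close>
      then have none: "R n = None" using R[of n] by (cases "R n") auto
      then have "(?h n, ?h c) \<in> edges ?E"
        unfolding edges_E using step by (auto simp: replaced_node_def)
      then show ?case using step.IH by (rule rtrancl_into_rtrancl[rotated])
    qed
    have "(root ?E, Inr (n, m)) \<in> (edges ?E)\<^sup>*"
      if n: "n \<in> nodes G" and C: "R n = Some C" and m: "m \<in> nodes C" for n m C
    proof -
      have "(root C, m) \<in> (edges C)\<^sup>*" using R[OF n C] m by (simp add: nnf_circuit_def)
      then have "(Inr (n, root C), Inr (n, m)) \<in> (edges ?E)\<^sup>*"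
      proof (induction rule: rtrancl_induct)
        case (step m m')
        have "(Inr (n, m), Inr (n, m')) \<in> edges ?E"
          unfolding edges_E using step n C by auto
        then show ?case using step.IH by (rule rtrancl_into_rtrancl[rotated])
      qed simp
      moreover have "(root ?E, Inr (n, root C)) \<in> (edges ?E)\<^sup>*"
        using reach[of n] n G C by (simp add: nnf_circuit_def replaced_node_def)
      ultimately show ?thesis by (rule rtrancl_trans[rotated])
    qed
    moreover have "(root ?E, Inl n) \<in> (edges ?E)\<^sup>*" if "n \<in> nodes G" "R n = None" for n
      using reach[of n] that G by (simp add: nnf_circuit_def replaced_node_def)
    ultimately show ?thesis by (auto simp: replace_leaves_def)
  qed
  ultimately show ?thesis unfolding nnf_circuit_def by blast
qed

section \<open>Circuits as monotone functions of three independent leaf values\<close>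

section \<open>Values of a circuit whose leaves labeled by one variable are set freely\<close>

text \<open>\<open>False\<close> at inner gates is a dummy: \<open>holds_at\<close> consults its
  valuation at leaves only.\<close>

definition leaf_value :: "('n, 'v) circuit \<Rightarrow> ('v \<Rightarrow> bool) \<Rightarrow> 'n \<Rightarrow> bool" where
  "leaf_value G s n = (case gate G n of Leaf a \<Rightarrow> eval (label_form a) s | _ \<Rightarrow> False)"

text \<open>Severing the tie between \<open>l\<close> and its negation is what makes the value
  monotone in \<open>a\<close>, \<open>b\<close> and \<open>c\<close>. As membership in
  \<open>S\<close> is tested first, \<open>b\<close> concerns only the remaining
  \<open>l\<close>-leaves.\<close>

definition split_value ::
  "('n, 'v) circuit \<Rightarrow> 'v literal \<Rightarrow> 'n set \<Rightarrow> bool \<Rightarrow> bool \<Rightarrow> bool \<Rightarrow> ('v \<Rightarrow> bool) \<Rightarrow> bool" where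
  "split_value G l S a b c s = holds_at G
     (\<lambda>n. if n \<in> S then a else if n \<in> lit_leaves G l then b
          else if n \<in> lit_leaves G (lit_neg l) then c else leaf_value G s n) (root G)"

text \<open>All leaves over \<open>lit_var l\<close> are overridden, so the assignment enters only
  through the other variables, where \<open>s\<close> and \<open>t\<close> agree; the rest is
  \<open>holds_at_mono\<close>.\<close>

lemma split_value_mono:
  assumes G: "nnf_circuit G"
    and le: "a \<le> a'" "b \<le> b'" "c \<le> c'"
    and agree: "\<And>x. x \<in> circuit_vars G - {lit_var l} \<Longrightarrow> s x = t x"
    and val: "split_value G l S a b c s"
  shows "split_value G l S a' b' c' t"
  using val unfolding split_value_def
proof (rule holds_at_mono[OF G nnf_root[OF G], rotated])
  fix n lab
  assume n: "n \<in> nodes G" "gate G n = Leaf lab"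
  have "leaf_value G s n = leaf_value G t n" if "n \<notin> lit_leaves G l" "n \<notin> lit_leaves G (lit_neg l)"
  proof (cases lab)
    case (Lit l')
    then have "l' \<noteq> l" "l' \<noteq> lit_neg l" using n that by (auto simp: lit_leaves_def)
    then have "lit_var l' \<noteq> lit_var l" using lit_var_eqD by blast
    moreover have "lit_var l' \<in> circuit_vars G"
      using n Lit by (auto simp: circuit_vars_def lit_leaves_def)
    ultimately have "s (lit_var l') = t (lit_var l')" using agree by blast
    then have "eval (lit_form l') s = eval (lit_form l') t" by (rule eval_lit_form_cong)
    then show ?thesis using n Lit by (simp add: leaf_value_def)
  qed (use n in \<open>simp add: leaf_value_def\<close>)
  moreover assume "if n \<in> S then a else if n \<in> lit_leaves G l then b
          else if n \<in> lit_leaves G (lit_neg l) then c else leaf_value G s n"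
  ultimately show "if n \<in> S then a' else if n \<in> lit_leaves G l then b'
          else if n \<in> lit_leaves G (lit_neg l) then c' else leaf_value G t n"
    using le unfolding le_bool_def by (simp split: if_splits)
qed

lemma split_value_cong:
  assumes "nnf_circuit G" "\<And>x. x \<in> circuit_vars G - {lit_var l} \<Longrightarrow> s x = t x"
  shows "split_value G l S a b c s = split_value G l S a b c t"
proof
  show "split_value G l S a b c t" if "split_value G l S a b c s"
    by (rule split_value_mono[OF assms(1) order_refl order_refl order_refl assms(2) that])
  show "split_value G l S a b c s" if "split_value G l S a b c t"
    by (rule split_value_mono[OF assms(1) order_refl order_refl order_refl assms(2)[symmetric] that])
qed

text \<open>One evaluation rule for all circuits derived from \<open>G\<close>: \<open>h\<close> is
  the identity for relabelings and \<open>replaced_node\<close> when leaves turn into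
  circuits.\<close>

lemma eval_split_value:
  assumes G: "nnf_circuit G"
    and S: "S \<subseteq> lit_leaves G l"
    and G': "nnf_circuit G'"
    and root: "root G' = h (root G)"
    and inner: "\<And>n. n \<in> nodes G \<Longrightarrow> \<nexists>a. gate G n = Leaf a \<Longrightarrow>
      h n \<in> nodes G' \<and> gate G' (h n) = map_gate h (gate G n)"
    and S_val: "\<And>n. n \<in> S \<Longrightarrow> eval (node_form G' (h n)) s = a"
    and l_val: "\<And>n. n \<in> lit_leaves G l - S \<Longrightarrow> eval (node_form G' (h n)) s = b"
    and neg_val: "\<And>n. n \<in> lit_leaves G (lit_neg l) \<Longrightarrow> eval (node_form G' (h n)) s = c"
    and other: "\<And>n lab. n \<in> nodes G \<Longrightarrow> gate G n = Leaf lab \<Longrightarrow> lab \<noteq> Lit l \<Longrightarrow> lab \<noteq> Lit (lit_neg l) \<Longrightarrow>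
      h n \<in> nodes G' \<and> gate G' (h n) = Leaf lab"
  shows "eval (circuit_form G') s = split_value G l S a b c s"
  unfolding circuit_form_def split_value_def root
proof (rule eval_node_form_embed[OF G nnf_root[OF G] G' _ inner])
  fix n lab
  assume n: "n \<in> nodes G" "gate G n = Leaf lab"
  have "eval (node_form G' (h n)) s = leaf_value G s n"
    if "n \<notin> lit_leaves G l" "n \<notin> lit_leaves G (lit_neg l)"
    using other[OF n] that n node_form_gate(1)[OF G']
    by (auto simp: lit_leaves_def leaf_value_def)
  then show "eval (node_form G' (h n)) s = (if n \<in> S then a else if n \<in> lit_leaves G l then b
          else if n \<in> lit_leaves G (lit_neg l) then c else leaf_value G s n)"
    using S_val[of n] l_val[of n] neg_val[of n] by simp
qed

lemma gate_map_id [simp]: "map_gate (\<lambda>n. n) g = g"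
  by (cases g) auto

lemma eval_circuit_form_split:
  assumes "nnf_circuit G" "S \<subseteq> lit_leaves G l"
  shows "eval (circuit_form G) s =
    split_value G l S (eval (lit_form l) s) (eval (lit_form l) s) (\<not> eval (lit_form l) s) s"
  by (rule eval_split_value[where h = "\<lambda>n. n"])
    (use assms in \<open>auto simp: lit_leaves_def node_form_gate subset_iff\<close>)

lemma eval_relabel_leaves_split:
  assumes "nnf_circuit G" "S \<subseteq> lit_leaves G l"
  shows "eval (circuit_form (relabel_leaves G S (Const b))) s =
    split_value G l S b (eval (lit_form l) s) (\<not> eval (lit_form l) s) s"
proof -
  have [simp]: "nodes (relabel_leaves G S (Const b)) = nodes G"
    "gate (relabel_leaves G S (Const b)) n = (if n \<in> S then Leaf (Const b) else gate G n)"
    "root (relabel_leaves G S (Const b)) = root G" for n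
    by (simp_all add: relabel_leaves_def)
  have nnf: "nnf_circuit (relabel_leaves G S (Const b))"
    using assms by (rule nnf_relabel_leaves)
  have notin: "gate G n = Leaf (Lit (lit_neg l)) \<Longrightarrow> n \<notin> S" for n
    using assms(2) by (auto simp: lit_leaves_def)
  show ?thesis
    by (rule eval_split_value[where h = "\<lambda>n. n"])
      (use assms nnf notin in \<open>auto simp: lit_leaves_def node_form_gate subset_iff\<close>)
qed

text \<open>By contraposition: if both disjuncts fail, then under \<open>t\<close>, with the other
  \<open>l\<close>-leaves at False, putting \<open>w\<close> on \<open>S\<close> and
  \<open>w'\<close> on the negated leaves yields exactly their conjunction, so \<open>S\<close> is
  realizable.\<close>

lemma unrealizable_split_value:
  fixes G :: "('n, 'v::infinite) circuit"
  assumes G: "nnf_circuit G" and S: "S \<subseteq> lit_leaves G l"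
    and unreal: "\<not> and_realizable_set G l S"
    and val: "split_value G l S True False True t"
  shows "split_value G l S True False False t \<or> split_value G l S False False True t"
proof (rule ccontr)
  assume neg: "\<not> ?thesis"
  define G' where "G' = relabel_leaves G (lit_leaves G l - S) (Const False)"
  have [simp]: "nodes G' = nodes G" "root G' = root G"
    "gate G' n = (if n \<in> lit_leaves G l - S then Leaf (Const False) else gate G n)" for n
    by (simp_all add: G'_def relabel_leaves_def)
  have G'_nnf: "nnf_circuit G'"
    unfolding G'_def using G by (rule nnf_relabel_leaves) auto
  have "lit_leaves G' l' = lit_leaves G l'" if "lit_var l' \<noteq> lit_var l" for l'
  proof -
    have "l' \<noteq> l" using that by blast
    then show ?thesis by (auto simp: lit_leaves_def)
  qed
  \<comment> \<open>Only leaves over \<open>lit_var l\<close> have changed; that variable itself may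
    have vanished from \<open>G'\<close>.\<close>
  then have vars: "circuit_vars G' - {lit_var l} = circuit_vars G - {lit_var l}"
    unfolding circuit_vars_def by blast
  let ?F = "insert (lit_var l) (circuit_vars G')"
  have fin: "finite ?F" using finite_circuit_vars[OF G'_nnf] by simp
  obtain w where w: "w \<notin> ?F" using ex_new_if_finite[OF infinite_UNIV fin] by blast
  obtain w' where w': "w' \<notin> insert w ?F"
    using ex_new_if_finite[OF infinite_UNIV, of "insert w ?F"] fin by blast
  have "w \<noteq> w'" using w' by blast
  \<comment> \<open>The realizing assignment: \<open>t\<close> cut down to the prescribed
    domain.\<close>
  define s where "s = (\<lambda>x. if x \<in> circuit_vars G' - {lit_var l} then Some (t x) else None)"
  let ?G'' = "relabel_lits G' (Lit(l := Lit (Pos w), lit_neg l := Lit (Pos w')))"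
  have nnf: "nnf_circuit ?G''" using G'_nnf by (rule nnf_relabel_lits)
  have [simp]: "nodes ?G'' = nodes G" "root ?G'' = root G" by (simp_all add: relabel_lits_def)
  \<comment> \<open>The \<open>l\<close>-leaves outside \<open>S\<close> are already constant in
    \<open>G'\<close>, so \<open>w\<close> reaches only \<open>S\<close>.\<close>
  have ev: "eval (circuit_form ?G'') u = split_value G l S (u w) False (u w') u" for u
  proof (rule eval_split_value[where h = "\<lambda>n. n", OF G S nnf])
    fix n assume "n \<in> nodes G" "\<nexists>a. gate G n = Leaf a"
    then show "n \<in> nodes ?G'' \<and> gate ?G'' n = map_gate (\<lambda>n. n) (gate G n)"
      by (subst gate_relabel_lits(2)) (auto simp: lit_leaves_def)
  next
    fix n assume "n \<in> S"
    then have "n \<in> nodes G" "gate ?G'' n = Leaf (Lit (Pos w))"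
      using S by (auto simp: lit_leaves_def gate_relabel_lits(1)[of _ _ l])
    then show "eval (node_form ?G'' n) u = u w"
      using nnf by (simp add: node_form_gate)
  next
    fix n assume "n \<in> lit_leaves G l - S"
    then have "n \<in> nodes G" "gate ?G'' n = Leaf (Const False)"
      by (auto simp: lit_leaves_def gate_relabel_lits(2))
    then show "eval (node_form ?G'' n) u = False"
      using nnf by (simp add: node_form_gate)
  next
    fix n assume "n \<in> lit_leaves G (lit_neg l)"
    then have "n \<in> nodes G" "gate ?G'' n = Leaf (Lit (Pos w'))"
      by (auto simp: lit_leaves_def gate_relabel_lits(1)[of _ _ "lit_neg l"])
    then show "eval (node_form ?G'' n) u = u w'"
      using nnf by (simp add: node_form_gate)
  next
    fix n lab assume n: "n \<in> nodes G" "gate G n = Leaf lab" "lab \<noteq> Lit l" "lab \<noteq> Lit (lit_neg l)"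
    then have "gate G' n = Leaf lab" by (auto simp: lit_leaves_def)
    then have "gate ?G'' n = Leaf lab"
      using n(3,4) by (cases lab) (auto simp: gate_relabel_lits)
    then show "n \<in> nodes ?G'' \<and> gate ?G'' n = Leaf lab" using n by simp
  qed simp
  have subst: "eval (subst_assignment s f) u = eval f (\<lambda>v. case s v of None \<Rightarrow> u v | Some b \<Rightarrow> b)" for f u
    unfolding subst_assignment_def by (induction f) (auto split: option.split)
  have "eval (subst_assignment s (circuit_form ?G'')) u = eval (FAnd (FVar w) (FVar w')) u" for u
  proof -
    let ?u = "\<lambda>v. case s v of None \<Rightarrow> u v | Some b \<Rightarrow> b"
    \<comment> \<open>\<open>w\<close> and \<open>w'\<close> lie outside the domain of
      \<open>s\<close>, so \<open>?u\<close> gives them their values under \<open>u\<close>.\<close>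
    have "eval (circuit_form ?G'') ?u = split_value G l S (u w) False (u w') ?u"
      unfolding ev using w w' by (simp add: s_def)
    also have "\<dots> = split_value G l S (u w) False (u w') t"
      by (rule split_value_cong[OF G]) (auto simp: s_def vars)
    \<comment> \<open>\<open>val\<close> settles the case of both true, \<open>neg\<close> the mixed
      cases, and monotonicity carries falsity from (False, True) down to both false.\<close>
    also have "\<dots> \<longleftrightarrow> u w \<and> u w'"
      using neg val split_value_mono[OF G, of False False False False False True l t t S]
      by (cases "u w"; cases "u w'") auto
    finally show ?thesis by (simp add: subst)
  qed
  then have "eval (subst_assignment s (circuit_form ?G'')) = eval (FAnd (FVar w) (FVar w'))"
    by (rule ext)
  moreover have "dom s = circuit_vars G' - {lit_var l}"
    by (auto simp: s_def dom_def)
  ultimately have "and_realizable_set G l S"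
    unfolding and_realizable_set_def and_realizable_def G'_def[symmetric]
    using w w' \<open>w \<noteq> w'\<close> by - (rule exI[of _ w], rule exI[of _ w'], rule exI[of _ s], simp)
  then show False using unreal by simp
qed

section \<open>The circuit \<open>E\<close> and its relabelings by constants\<close>

section \<open>The circuit that splits off the remaining leaves\<close>

text \<open>\<open>p\<close> is a selector: true admits the \<open>l\<close>-leaves outside
  \<open>S\<close>, false the negated leaves, never both.\<close>

definition split_circuit ::
  "('n, 'v) circuit \<Rightarrow> 'v literal \<Rightarrow> 'n set \<Rightarrow> 'v \<Rightarrow> ('n + 'n \<times> nat, 'v) circuit" where
  "split_circuit G l S p = replace_leaves G (\<lambda>n.
     if n \<in> lit_leaves G l - S then Some (lit_conj_circuit (Pos p) l)
     else if n \<in> lit_leaves G (lit_neg l) then Some (lit_conj_circuit (Neg p) (lit_neg l))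
     else None)"

lemma nnf_split_circuit: "nnf_circuit G \<Longrightarrow> nnf_circuit (split_circuit G l S p)"
  unfolding split_circuit_def
  by (rule nnf_replace_leaves) (auto simp: nnf_lit_conj_circuit lit_leaves_def split: if_splits)

text \<open>\<open>b = True\<close> gives \<open>H\<close>, and \<open>b = False\<close> the circuit
  behind the Skolem function for \<open>l\<close>. With \<open>l\<close> at True, its conjunction
  with \<open>p\<close> reduces to \<open>p\<close>.\<close>

lemma eval_relabel_split_circuit:
  fixes G :: "('n, 'v) circuit"
  assumes G: "nnf_circuit G" and S: "S \<subseteq> lit_leaves G l" and p: "p \<noteq> lit_var l"
  shows "eval (circuit_form (relabel_lits (split_circuit G l S p)
      (Lit(l := Const True, lit_neg l := Const b)))) s =
    split_value G l S True (s p) (\<not> s p \<and> b) s"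
proof -
  define R :: "'n \<Rightarrow> (nat, 'v) circuit option" where "R = (\<lambda>n.
     if n \<in> lit_leaves G l - S then Some (lit_conj_circuit (Pos p) l)
     else if n \<in> lit_leaves G (lit_neg l) then Some (lit_conj_circuit (Neg p) (lit_neg l))
     else None)"
  define f where "f = Lit(l := Const True, lit_neg l := Const b)"
  define E where "E = relabel_lits (split_circuit G l S p) f"
  have nnf: "nnf_circuit E"
    unfolding E_def by (intro nnf_relabel_lits nnf_split_circuit G)
  have E: "split_circuit G l S p = replace_leaves G R"
    by (simp add: split_circuit_def R_def)
  \<comment> \<open>\<open>p \<noteq> lit_var l\<close> keeps the relabeling away from the leaves
    over \<open>p\<close> in the copies.\<close>
  have f [simp]: "f (Pos p) = Lit (Pos p)" "f (Neg p) = Lit (Neg p)"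
    "f l = Const True" "f (lit_neg l) = Const b"
    using p by (cases l; simp add: f_def)+
  have root: "root E = replaced_node R (root G)"
    unfolding E_def E relabel_lits_def replace_leaves_def by simp
  have nodes: "Inl n \<in> nodes E \<longleftrightarrow> n \<in> nodes G \<and> R n = None"
    "Inr (n, m) \<in> nodes E \<longleftrightarrow> n \<in> nodes G \<and> (\<exists>C. R n = Some C \<and> m \<in> nodes C)" for n m
    unfolding E_def E relabel_lits_def replace_leaves_def by auto
  have gate_Inl: "gate E (Inl n) = (case gate G n of Leaf (Lit l') \<Rightarrow> Leaf (f l')
      | g \<Rightarrow> map_gate (replaced_node R) g)" for n
    unfolding E_def E relabel_lits_def replace_leaves_def
    by (auto split: gate.split leaf_label.split)
  have gate_Inr: "gate E (Inr (n, m)) =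
      (if m = 0 then AndGate (Inr (n, 1)) (Inr (n, 2))
       else if m = 1 then Leaf (f l1) else Leaf (f l2))"
    if "R n = Some (lit_conj_circuit l1 l2)" for n m l1 l2
    using that unfolding E_def E relabel_lits_def replace_leaves_def
    by (simp add: lit_conj_circuit_def)
  have copy: "eval (node_form E (replaced_node R n)) s \<longleftrightarrow>
      eval (label_form (f l1)) s \<and> eval (label_form (f l2)) s"
    if "n \<in> nodes G" "R n = Some (lit_conj_circuit l1 l2)" for n l1 l2
  proof -
    have "eval (node_form E (Inr (n, 0))) s \<longleftrightarrow>
      eval (label_form (f l1)) s \<and> eval (label_form (f l2)) s"
      using nnf that
      by (intro eval_lit_conj_copy[where f = "\<lambda>m. Inr (n, m)"])
        (auto simp: gate_Inr nodes lit_conj_circuit_def)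
    then show ?thesis
      using that by (simp add: replaced_node_def lit_conj_circuit_def)
  qed
  have "eval (circuit_form E) s = split_value G l S True (s p) (\<not> s p \<and> b) s"
  proof (rule eval_split_value[where h = "replaced_node R", OF G S nnf root])
    fix n assume "n \<in> nodes G" "\<nexists>a. gate G n = Leaf a"
    then show "replaced_node R n \<in> nodes E \<and> gate E (replaced_node R n) = map_gate (replaced_node R) (gate G n)"
      by (auto simp: replaced_node_def R_def lit_leaves_def nodes gate_Inl split: gate.splits)
  next
    fix n assume "n \<in> S"
    then have "n \<in> nodes G" "gate G n = Leaf (Lit l)" "R n = None"
      using S by (auto simp: R_def lit_leaves_def)
    then show "eval (node_form E (replaced_node R n)) s = True"
      using nnf by (simp add: replaced_node_def node_form_gate nodes gate_Inl)
  next
    fix n assume "n \<in> lit_leaves G l - S"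
    then have "n \<in> nodes G" "R n = Some (lit_conj_circuit (Pos p) l)"
      by (auto simp: R_def lit_leaves_def)
    then show "eval (node_form E (replaced_node R n)) s = s p"
      by (simp add: copy)
  next
    fix n assume "n \<in> lit_leaves G (lit_neg l)"
    then have "n \<in> nodes G" "R n = Some (lit_conj_circuit (Neg p) (lit_neg l))"
      by (auto simp: R_def lit_leaves_def)
    then show "eval (node_form E (replaced_node R n)) s = (\<not> s p \<and> b)"
      by (simp add: copy)
  next
    fix n lab assume "n \<in> nodes G" "gate G n = Leaf lab" "lab \<noteq> Lit l" "lab \<noteq> Lit (lit_neg l)"
    then show "replaced_node R n \<in> nodes E \<and> gate E (replaced_node R n) = Leaf lab"
      by (auto simp: replaced_node_def R_def lit_leaves_def nodes gate_Inl f_def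
          split: leaf_label.splits)
  qed
  then show ?thesis by (simp add: E_def f_def)
qed

text \<open>Serves to show that the Skolem function for \<open>l\<close> mentions inputs only. The
  copies contribute no variable but \<open>p\<close>, since their other leaf becomes a
  constant.\<close>

lemma form_vars_relabel_split_circuit:
  fixes G :: "('n, 'v) circuit"
  assumes G: "nnf_circuit G"
  shows "form_vars (circuit_form (relabel_lits (split_circuit G l S p)
      (Lit(l := Const a, lit_neg l := Const b)))) \<subseteq> insert p (circuit_vars G - {lit_var l})"
proof -
  define E where "E = relabel_lits (split_circuit G l S p) (Lit(l := Const a, lit_neg l := Const b))"
  have nnf: "nnf_circuit E" unfolding E_def by (intro nnf_relabel_lits nnf_split_circuit G)
  have "lit_var l' \<in> insert p (circuit_vars G - {lit_var l})"
    if x: "x \<in> nodes E" "gate E x = Leaf (Lit l')" for l' x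
  proof -
    obtain l0 where l0: "gate (split_circuit G l S p) x = Leaf (Lit l0)"
      "(Lit(l := Const a, lit_neg l := Const b)) l0 = Lit l'"
      using x(2) by (auto simp: E_def relabel_lits_def simp del: fun_upd_apply
          split: gate.splits leaf_label.splits)
    \<comment> \<open>Both literals over \<open>lit_var l\<close> became constants, so a surviving
      literal was left unchanged.\<close>
    then have l': "l' \<noteq> l" "l' \<noteq> lit_neg l" and
      lab: "gate (split_circuit G l S p) x = Leaf (Lit l')"
      by (auto split: if_splits)
    have "l' \<in> {Pos p, Neg p} \<or> lit_leaves G l' \<noteq> {}"
    proof (cases x)
      case (Inl n)
      then have "n \<in> nodes G" using x(1)
        by (auto simp: E_def relabel_lits_def split_circuit_def replace_leaves_def)
      moreover have "gate G n = Leaf (Lit l')"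
        using lab Inl by (cases "gate G n") (auto simp: split_circuit_def replace_leaves_def)
      ultimately show ?thesis by (auto simp: lit_leaves_def)
    next
      case (Inr nm)
      then obtain n m where x_eq: "x = Inr (n, m)" by (cases nm) auto
      have "n \<in> lit_leaves G l - S \<or> n \<in> lit_leaves G (lit_neg l)"
        using x(1) x_eq
        by (auto simp: E_def relabel_lits_def split_circuit_def replace_leaves_def split: if_splits)
      then have "l' \<in> {Pos p, l, Neg p, lit_neg l}"
        using lab by (auto simp: x_eq split_circuit_def replace_leaves_def lit_conj_circuit_def
            split: if_splits)
      then show ?thesis using l' by blast
    qed
    then show ?thesis
    proof
      assume "lit_leaves G l' \<noteq> {}"
      then have "lit_var l' \<in> circuit_vars G" unfolding circuit_vars_def by blast
      moreover have "lit_var l' \<noteq> lit_var l" using l' lit_var_eqD by blast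
      ultimately show ?thesis by simp
    qed auto
  qed
  then have "circuit_vars E \<subseteq> insert p (circuit_vars G - {lit_var l})"
    by (auto simp: circuit_vars_def[of E] lit_leaves_def[of E])
  moreover have "form_vars (circuit_form E) \<subseteq> circuit_vars E"
    unfolding circuit_form_def using nnf nnf_root[OF nnf] by (rule form_vars_node_form)
  ultimately show ?thesis unfolding E_def by (rule subset_trans[rotated])
qed

section \<open>Iterated quantifiers, substitution and Skolem vectors\<close>

section \<open>Quantification and Skolem vectors\<close>

text \<open>One choice of assignment replaces the chain of quantifiers, which makes \<open>X\<close>
  comparable with the list having \<open>p\<close> in place of \<open>lit_var l\<close>.\<close>

lemma ex_vars_iff: "ex_vars Y F s \<longleftrightarrow> (\<exists>t. (\<forall>x. x \<notin> set Y \<longrightarrow> t x = s x) \<and> F t)"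
proof (induction Y arbitrary: s)
  case Nil
  have "(\<forall>x. t x = s x) \<longleftrightarrow> t = s" for t by auto
  then show ?case by (simp add: ex_vars_def)
next
  case (Cons y Y)
  have upd: "(\<exists>b. \<forall>x. x \<notin> set Y \<longrightarrow> t x = (s(y := b)) x) \<longleftrightarrow> (\<forall>x. x \<notin> set (y # Y) \<longrightarrow> t x = s x)"
    (is "?L \<longleftrightarrow> ?R") for t
  proof
    assume ?R
    then have "\<forall>x. x \<notin> set Y \<longrightarrow> t x = (s(y := t y)) x" by simp
    then show ?L ..
  qed auto
  have "ex_vars (y # Y) F s \<longleftrightarrow> (\<exists>b. ex_vars Y F (s(y := b)))"
    by (simp add: ex_vars_def ex_var_def)
  also have "\<dots> \<longleftrightarrow> (\<exists>t. (\<exists>b. \<forall>x. x \<notin> set Y \<longrightarrow> t x = (s(y := b)) x) \<and> F t)"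
    unfolding Cons.IH by blast
  finally show ?case unfolding upd .
qed

lemma eval_subst: "eval (subst r f) s = eval f (\<lambda>v. eval (r v) s)"
  by (induction f) auto

lemma form_vars_subst: "form_vars (subst r f) = (\<Union>v \<in> form_vars f. form_vars (r v))"
  by (induction f) auto

lemma form_vars_var_skolem [simp]: "form_vars (var_skolem l g) = form_vars g"
  by (cases l) auto

lemma vector_subst_map: "vector_subst X (map f X) v = (if v \<in> set X then f v else FVar v)"
  by (simp add: vector_subst_def map_of_zip_map)

lemma vector_subst_notin:
  "length \<Psi> = length Y \<Longrightarrow> v \<notin> set Y \<Longrightarrow> vector_subst Y \<Psi> v = FVar v"
  by (simp add: vector_subst_def map_of_zip_is_None[THEN iffD2])

lemma vector_subst_in:
  assumes "length \<Psi> = length Y" "v \<in> set Y"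
  shows "vector_subst Y \<Psi> v \<in> set \<Psi>"
proof -
  obtain f where "map_of (zip Y \<Psi>) v = Some f"
    using map_of_zip_is_Some[of Y \<Psi> v] assms by auto
  then show ?thesis
    unfolding vector_subst_def by (auto dest: map_of_SomeD set_zip_rightD)
qed

section \<open>The equivalences and the transfer of the Skolem vector\<close>

theorem theorem1:
  fixes G :: "('n, 'v::infinite) circuit"
    and X I :: "'v list"
    and l :: "'v literal"
    and S :: "'n set"
    and p :: 'v
    and E H :: "('n + 'n \<times> nat, 'v) circuit"
  assumes "distinct X" and "distinct I" and "set X \<inter> set I = {}"
    and "nnf_circuit G"
    and "circuit_vars G \<subseteq> set X \<union> set I"
    and "lit_var l \<in> set X"
    and "S \<subseteq> lit_leaves G l"
    and "\<not> and_realizable_set G l S"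
    and "p \<notin> set X \<union> set I"
    and "E = replace_leaves G (\<lambda>n.
               if n \<in> lit_leaves G l - S then Some (lit_conj_circuit (Pos p) l)
               else if n \<in> lit_leaves G (lit_neg l) then Some (lit_conj_circuit (Neg p) (lit_neg l))
               else None)"
    and "H = relabel_lits E (Lit(l := Const True, lit_neg l := Const True))"
  shows "(ex_var (lit_var l) (eval (circuit_form G)) = ex_var p (eval (circuit_form H)) \<and>
          ex_var p (eval (circuit_form H)) =
            ex_var (lit_var l) (eval (circuit_form (relabel_leaves G S (Const True))))) \<and>
         (\<forall>\<Psi>. skolem_vector (removeAll (lit_var l) X @ [p]) I (circuit_form H) \<Psi> \<longrightarrow>
            (let r = vector_subst (removeAll (lit_var l) X @ [p]) \<Psi>;
                 g = subst r (circuit_form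
                       (relabel_lits E (Lit(l := Const True, lit_neg l := Const False))))
             in skolem_vector X I (circuit_form G)
                  (map (\<lambda>x. if x = lit_var l then var_skolem l g else r x) X)))"
proof -
  define K where "K = split_value G l S"
  define L where "L = eval (lit_form l)"
  let ?v = "lit_var l"
  let ?Y = "removeAll ?v X @ [p]"
  have p: "p \<noteq> ?v" "p \<notin> circuit_vars G" using assms(5,6,9) by auto
  have E: "E = split_circuit G l S p" using assms(10) by (simp add: split_circuit_def)
  note G = \<open>nnf_circuit G\<close> and S = \<open>S \<subseteq> lit_leaves G l\<close>
  have eval_G: "eval (circuit_form G) s = K (L s) (L s) (\<not> L s) s" for s
    unfolding K_def L_def using G S by (rule eval_circuit_form_split)
  have eval_GS: "eval (circuit_form (relabel_leaves G S (Const True))) s = K True (L s) (\<not> L s) s" for s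
    unfolding K_def L_def using G S by (rule eval_relabel_leaves_split)
  have eval_H: "eval (circuit_form H) s = K True (s p) (\<not> s p) s" for s
    unfolding K_def assms(11) E eval_relabel_split_circuit[OF G S p(1)] by simp
  have eval_g: "eval (circuit_form (relabel_lits E (Lit(l := Const True, lit_neg l := Const False)))) s
      = K True (s p) False s" for s
    unfolding K_def E eval_relabel_split_circuit[OF G S p(1)] by simp
  have mono: "K a' b' c' s"
    if "K a b c s" "a \<le> a'" "b \<le> b'" "c \<le> c'" for a b c a' b' c' s
    using that split_value_mono[OF G] unfolding K_def by blast
  have cong: "K a b c s = K a b c t" if "\<And>x. x \<in> circuit_vars G - {?v} \<Longrightarrow> s x = t x" for a b c s t
    unfolding K_def using G that by (rule split_value_cong)
  \<comment> \<open>\<open>p\<close> does not occur in \<open>G\<close>, and leaves over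
    \<open>?v\<close> are set by the arguments of \<open>K\<close>.\<close>
  have K_upd: "K a b c (s(p := d)) = K a b c s" "K a b c (s(?v := d)) = K a b c s" for a b c d s
    by (rule cong; use p in auto)+
  have unreal: "K True False False s \<or> K False False True s" if "K True False True s" for s
    using unrealizable_split_value[OF G S assms(8)] that unfolding K_def by blast
  \<comment> \<open>Quantifying \<open>?v\<close> thus amounts to quantifying the value of
    \<open>l\<close>; for a negative literal the witness is flipped.\<close>
  have "\<exists>d. L (s(?v := d)) = b" for b s
    by (cases l) (auto simp: L_def intro: exI[of _ "\<not> b"])
  then have ex_L: "(\<exists>d. P (L (s(?v := d)))) \<longleftrightarrow> P True \<or> P False" for P s
    by (metis (full_types))
  have ex_G: "ex_var ?v (eval (circuit_form G)) s \<longleftrightarrow> K True True False s \<or> K False False True s" for s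
    unfolding ex_var_def eval_G K_upd by (subst ex_L) simp
  have ex_GS: "ex_var ?v (eval (circuit_form (relabel_leaves G S (Const True)))) s
      \<longleftrightarrow> K True True False s \<or> K True False True s" for s
    unfolding ex_var_def eval_GS K_upd by (subst ex_L) simp
  have ex_H: "ex_var p (eval (circuit_form H)) s \<longleftrightarrow> K True True False s \<or> K True False True s" for s
    unfolding ex_var_def eval_H K_upd by (simp add: ex_bool_eq)
  \<comment> \<open>Left to right is monotonicity. Right to left, \<open>unreal\<close> splits
    \<open>K True False True\<close>: \<open>K True False False\<close> lies below
    \<open>K True True False\<close>, and the other alternative is a disjunct on the left.\<close>
  have "K True True False s \<or> K False False True s \<longleftrightarrow> K True True False s \<or> K True False True s" for s
    using unreal[of s] mono[of True False False s True True False]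
      mono[of False False True s True False True] by auto
  then have ex_eq: "ex_var ?v (eval (circuit_form G)) = ex_var p (eval (circuit_form H))"
    "ex_var p (eval (circuit_form H)) = ex_var ?v (eval (circuit_form (relabel_leaves G S (Const True))))"
    by (auto simp: fun_eq_iff ex_G ex_H ex_GS)

  have "skolem_vector X I (circuit_form G) (map (\<lambda>x. if x = ?v then var_skolem l g else r x) X)"
    if sk: "skolem_vector ?Y I (circuit_form H) \<Psi>"
      and r: "r = vector_subst ?Y \<Psi>"
      and g: "g = subst r (circuit_form (relabel_lits E (Lit(l := Const True, lit_neg l := Const False))))"
    for \<Psi> r g
  proof -
    let ?f = "\<lambda>x. if x = ?v then var_skolem l g else r x"
    have len: "length \<Psi> = length ?Y" and vars: "\<And>h. h \<in> set \<Psi> \<Longrightarrow> form_vars h \<subseteq> set I"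
      and sk_H: "\<And>s. eval (subst r (circuit_form H)) s \<longleftrightarrow> ex_vars ?Y (eval (circuit_form H)) s"
      using sk unfolding skolem_vector_def r by auto
    have r_in: "form_vars (r x) \<subseteq> set I" if "x \<in> set ?Y" for x
      unfolding r using vector_subst_in[OF len that] by (rule vars)
    have r_out: "r x = FVar x" if "x \<notin> set ?Y" for x
      unfolding r using len that by (rule vector_subst_notin)
    \<comment> \<open>Variables in \<open>?Y\<close>, among them \<open>p\<close>, are replaced by
      formulas over \<open>I\<close>; any other variable of the circuit is an input and
      stays.\<close>
    have "form_vars g \<subseteq> set I"
    proof -
      have "form_vars (r x) \<subseteq> set I" if "x \<in> insert p (circuit_vars G - {?v})" for x
        using that r_in[of x] r_out[of x] assms(5) by (cases "x \<in> set ?Y") auto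
      then show ?thesis
        unfolding g form_vars_subst E using form_vars_relabel_split_circuit[OF G] by fastforce
    qed
    then have f_vars: "\<forall>h \<in> set (map ?f X). form_vars h \<subseteq> set I"
      using r_in by auto
    have "eval (subst (vector_subst X (map ?f X)) (circuit_form G)) s \<longleftrightarrow> ex_vars X (eval (circuit_form G)) s"
      for s
    proof -
      \<comment> \<open>\<open>t\<close> follows the Skolem vector of \<open>H\<close>,
        \<open>t'\<close> the candidate for \<open>G\<close>. They can differ only at
        \<open>?v\<close> and \<open>p\<close>, which \<open>K\<close> ignores.\<close>
      define t where "t = (\<lambda>x. eval (r x) s)"
      define t' where "t' = (\<lambda>x. eval (vector_subst X (map ?f X) x) s)"
      have L_t': "L t' = K True (t p) False t"
      proof -
        \<comment> \<open>For a negative literal the negation in \<open>var_skolem\<close> cancels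
          that of the literal.\<close>
        have "L t' = eval g s"
          using assms(6) by (cases l) (simp_all add: L_def t'_def vector_subst_map)
        then show ?thesis unfolding g eval_subst eval_g t_def .
      qed
      have "K a b c t' = K a b c t" for a b c
      proof (rule cong)
        fix x assume "x \<in> circuit_vars G - {?v}"
        then have "x \<noteq> ?v" "x \<noteq> p" using p(2) by auto
        then show "t' x = t x" by (simp add: t_def t'_def vector_subst_map r_out)
      qed
      then have eval_t': "eval (circuit_form G) t' = K (L t') (L t') (\<not> L t') t"
        by (simp add: eval_G)
      have "eval (circuit_form G) t' \<longleftrightarrow> ex_vars X (eval (circuit_form G)) s"
      proof
        assume "eval (circuit_form G) t'"
        moreover have "t' x = s x" if "x \<notin> set X" for x
          using that by (simp add: t'_def vector_subst_map)
        ultimately show "ex_vars X (eval (circuit_form G)) s"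
          unfolding ex_vars_iff by blast
      next
        assume "ex_vars X (eval (circuit_form G)) s"
        then obtain u where u: "\<And>x. x \<notin> set X \<Longrightarrow> u x = s x" "eval (circuit_form G) u"
          unfolding ex_vars_iff by blast
        have "ex_var ?v (eval (circuit_form G)) u"
          unfolding ex_var_def using u(2) by (intro exI[of _ "u ?v"]) simp
        then obtain b where "eval (circuit_form H) (u(p := b))"
          unfolding ex_eq(1) unfolding ex_var_def by blast
        \<comment> \<open>\<open>?v\<close> is not in \<open>?Y\<close>, so it must return to its
          value under \<open>s\<close>; \<open>H\<close> does not depend on it.\<close>
        then have "eval (circuit_form H) (u(p := b, ?v := s ?v))"
          using p(1) by (simp add: eval_H K_upd)
        then have "ex_vars ?Y (eval (circuit_form H)) s"
          unfolding ex_vars_iff using u(1) by (intro exI[of _ "u(p := b, ?v := s ?v)"]) auto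
        then have H: "K True (t p) (\<not> t p) t"
          using sk_H[of s] unfolding eval_subst t_def[symmetric] by (simp add: eval_H)
        show "eval (circuit_form G) t'"
        proof (cases "K True (t p) False t")
          case True
          \<comment> \<open>Here \<open>l\<close> receives True, and raising the
            \<open>l\<close>-leaves outside \<open>S\<close> preserves the value.\<close>
          then show ?thesis
            using mono[OF True, of True True False] by (simp add: eval_t' L_t')
        next
          case False
          \<comment> \<open>Were \<open>t p\<close> true, the fact \<open>H\<close> would be the
            very value that fails here.\<close>
          then have "\<not> t p" using H by (cases "t p") auto
          \<comment> \<open>The alternative \<open>K True False False t\<close> fails, and what
            remains is \<open>G\<close> with \<open>l\<close> false, as \<open>g\<close>
            prescribes.\<close>
          then have "K False False True t" using H False unreal[of t] by simp
          then show ?thesis using False by (simp add: eval_t' L_t')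
        qed
      qed
      then show ?thesis by (simp add: eval_subst t'_def)
    qed
    then show ?thesis using f_vars unfolding skolem_vector_def by simp
  qed
  then show ?thesis using ex_eq by (simp add: Let_def)
qed

end
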